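(* The set $\Lambda$ is self-similar, that is, $F(\Lambda)=\Lambda$.
   Context: $X=\mathbb{R}/\mathbb{Z}$, $T:X\to X$ is the doubling map $T(x)=2x$, $0<\lambda<1$ is fixed, $\mathcal{C}=\{0,\dots,m-1\}$ with $m\ge 2$, and $A_c:X\to\mathbb{R}$ ($c\in\mathcal{C}$) are Lipschitz functions. $G_c(x,y)=(T(x),A_c(x)+\lambda y)$ on $X\times\mathbb{R}$, and $F(U)=\bigcup_{c\in\mathcal{C}}G_c(U)$ for $U\subseteq X\times\mathbb{R}$. $\Lambda$ is the set of $(x,y)\in X\times\mathbb{R}$ for which there exist $M>0$, $\bar c=(c_0,c_1,\dots)\in\mathcal{C}^{\mathbb{N}}$ and a sequence $(x_n,y_n)_{n\ge0}$ in $X\times\mathbb{R}$ with $(x_0,y_0)=(x,y)$, $G_{c_n}(x_{n+1},y_{n+1})=(x_n,y_n)$ and $|y_n|\le M$ for all $n\geq 0$. Equivalently, $\Lambda=\{(x,S_x(\bar c,\bar a)): x\in X,\ \bar c\in\mathcal{C}^{\mathbb{N}},\ \bar a\in\{0,1\}^{\mathbb{N}}\}$, where $S_x(\bar c,\bar a)=\sum_{i\ge0}\lambda^iA_{c_i}(\tau_{a_i}\circ\cdots\circ\tau_{a_0}(x))$ and $\tau_i(x)=\frac12x+\frac i2$ (with $x\in[0,1)$ as representative), $i=0,1$, are the inverse branches of $T$. *)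

theory Defs
  imports "HOL-Analysis.Analysis"
begin

quotient_type circle = real / "\<lambda>a b. a - b \<in> \<int>"
proof (rule equivpI)
  show "reflp (\<lambda>a b::real. a - b \<in> \<int>)"
    by (simp add: reflp_def)
  show "symp (\<lambda>a b::real. a - b \<in> \<int>)"
    by (metis (no_types, lifting) Ints_minus minus_diff_eq sympI)
  show "transp (\<lambda>a b::real. a - b \<in> \<int>)"
  proof (rule transpI)
    fix a b c :: real
    assume "a - b \<in> \<int>" "b - c \<in> \<int>"
    then have "(a - b) + (b - c) \<in> \<int>" by (rule Ints_add)
    then show "a - c \<in> \<int>" by simp
  qed
qed

lift_definition doubling :: "circle \<Rightarrow> circle" is "\<lambda>a. 2 * a"
proof -
  fix a b :: real
  assume "a - b \<in> \<int>"
  then have "2 * (a - b) \<in> \<int>"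
    by (intro Ints_mult) auto
  then show "2 * a - 2 * b \<in> \<int>"
    by (simp add: algebra_simps)
qed

lemma bdd_below_abs_shifts: "bdd_below (range (\<lambda>k::int. \<bar>(a::real) - b + of_int k\<bar>))"
  by (rule bdd_belowI[of _ 0]) auto

text \<open>The quotient metric: the infimum of the distances between representatives.\<close>

lift_definition circle_dist :: "circle \<Rightarrow> circle \<Rightarrow> real"
  is "\<lambda>a b. INF k::int. \<bar>a - b + of_int k\<bar>"
proof -
  fix a a' b b' :: real
  assume "a - a' \<in> \<int>" "b - b' \<in> \<int>"
  then obtain p q :: int where p: "a - a' = of_int p" and q: "b - b' = of_int q"
    by (meson Ints_cases)
  have "range (\<lambda>k::int. \<bar>a - b + of_int k\<bar>) = range (\<lambda>k::int. \<bar>a' - b' + of_int k\<bar>)"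
  proof (intro equalityI image_subsetI)
    fix k :: int
    have "\<bar>a - b + of_int k\<bar> = \<bar>a' - b' + of_int (k + p - q)\<bar>"
      using p q by simp
    then show "\<bar>a - b + of_int k\<bar> \<in> range (\<lambda>k::int. \<bar>a' - b' + of_int k\<bar>)"
      by blast
  next
    fix k :: int
    have "\<bar>a' - b' + of_int k\<bar> = \<bar>a - b + of_int (k - p + q)\<bar>"
      using p q by simp
    then show "\<bar>a' - b' + of_int k\<bar> \<in> range (\<lambda>k::int. \<bar>a - b + of_int k\<bar>)"
      by blast
  qed
  then show "(INF k::int. \<bar>a - b + of_int k\<bar>) = (INF k::int. \<bar>a' - b' + of_int k\<bar>)"
    by simp
qed

lemma INF_abs_shifts_attained:
  fixes a b :: real
  obtains k :: int where "(INF k::int. \<bar>a - b + of_int k\<bar>) = \<bar>a - b + of_int k\<bar>"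
proof -
  let ?k0 = "- round (a - b)"
  have "(INF k::int. \<bar>a - b + of_int k\<bar>) = \<bar>a - b + of_int ?k0\<bar>"
  proof (rule antisym)
    show "(INF k::int. \<bar>a - b + of_int k\<bar>) \<le> \<bar>a - b + of_int ?k0\<bar>"
      by (rule cINF_lower[OF bdd_below_abs_shifts]) simp
    have "\<bar>a - b + of_int ?k0\<bar> \<le> \<bar>a - b + of_int k\<bar>" for k :: int
      using round_diff_minimal[of "a - b" "- k"] by simp
    then show "\<bar>a - b + of_int ?k0\<bar> \<le> (INF k::int. \<bar>a - b + of_int k\<bar>)"
      by (intro cINF_greatest) auto
  qed
  then show thesis by (rule that)
qed

instantiation circle :: metric_space
begin

definition dist_circle :: "circle \<Rightarrow> circle \<Rightarrow> real"
  where "dist_circle = circle_dist"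

definition uniformity_circle :: "(circle \<times> circle) filter"
  where "uniformity_circle = (INF e\<in>{0 <..}. principal {(x, y). dist x y < e})"

definition open_circle :: "circle set \<Rightarrow> bool"
  where "open_circle U \<longleftrightarrow> (\<forall>x\<in>U. eventually (\<lambda>(x', y). x' = x \<longrightarrow> y \<in> U) uniformity)"

instance
proof
  show "uniformity = (INF e\<in>{0 <..}. principal {(x::circle, y). dist x y < e})"
    by (rule uniformity_circle_def)
  show "open U \<longleftrightarrow> (\<forall>x\<in>U. eventually (\<lambda>(x', y). x' = x \<longrightarrow> y \<in> U) uniformity)"
    for U :: "circle set"
    by (rule open_circle_def)
  show "dist x y = 0 \<longleftrightarrow> x = y" for x y :: circle
    unfolding dist_circle_def
  proof transfer
    fix a b :: real
    obtain k :: int where k: "(INF k::int. \<bar>a - b + of_int k\<bar>) = \<bar>a - b + of_int k\<bar>"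
      by (rule INF_abs_shifts_attained)
    show "(INF k::int. \<bar>a - b + of_int k\<bar>) = 0 \<longleftrightarrow> a - b \<in> \<int>"
    proof
      assume "(INF k::int. \<bar>a - b + of_int k\<bar>) = 0"
      then have "a - b = of_int (- k)" using k by simp
      then show "a - b \<in> \<int>" using Ints_of_int by metis
    next
      assume "a - b \<in> \<int>"
      then obtain p :: int where "a - b = of_int p" by (meson Ints_cases)
      then have "(INF k::int. \<bar>a - b + of_int k\<bar>) \<le> 0"
        using cINF_lower[OF bdd_below_abs_shifts[of a b], of "- p"] by simp
      then show "(INF k::int. \<bar>a - b + of_int k\<bar>) = 0" using k by simp
    qed
  qed
  show "dist x y \<le> dist x z + dist y z" for x y z :: circle
    unfolding dist_circle_def
  proof transfer
    fix a b c :: real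
    obtain k :: int where k: "(INF k::int. \<bar>a - c + of_int k\<bar>) = \<bar>a - c + of_int k\<bar>"
      by (rule INF_abs_shifts_attained)
    obtain l :: int where l: "(INF k::int. \<bar>b - c + of_int k\<bar>) = \<bar>b - c + of_int l\<bar>"
      by (rule INF_abs_shifts_attained)
    have "(INF k::int. \<bar>a - b + of_int k\<bar>) \<le> \<bar>a - b + of_int (k - l)\<bar>"
      by (rule cINF_lower[OF bdd_below_abs_shifts]) simp
    also have "\<dots> \<le> \<bar>a - c + of_int k\<bar> + \<bar>b - c + of_int l\<bar>"
      by simp
    finally show "(INF k::int. \<bar>a - b + of_int k\<bar>)
        \<le> (INF k::int. \<bar>a - c + of_int k\<bar>) + (INF k::int. \<bar>b - c + of_int k\<bar>)"
      using k l by simp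
  qed
qed

end

text \<open>The contraction factor \<open>\<lambda>\<close> is written \<open>l\<close>. A family \<open>A\<close> indexed by
  \<open>{0, \<dots>, m - 1}\<close> is a function on \<open>nat\<close> whose values at indices \<open>\<ge> m\<close> are never used.\<close>

definition skew :: "real \<Rightarrow> (nat \<Rightarrow> circle \<Rightarrow> real) \<Rightarrow> nat \<Rightarrow> circle \<times> real \<Rightarrow> circle \<times> real"
  where "skew l A c = (\<lambda>(x, y). (doubling x, A c x + l * y))"

definition skew_union ::
    "real \<Rightarrow> nat \<Rightarrow> (nat \<Rightarrow> circle \<Rightarrow> real) \<Rightarrow> (circle \<times> real) set \<Rightarrow> (circle \<times> real) set"
  where "skew_union l m A U = (\<Union>c\<in>{..<m}. skew l A c ` U)"

text \<open>The set \<open>\<Lambda>\<close>.\<close>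

definition bounded_past_set ::
    "real \<Rightarrow> nat \<Rightarrow> (nat \<Rightarrow> circle \<Rightarrow> real) \<Rightarrow> (circle \<times> real) set"
  where "bounded_past_set l m A =
    {p. \<exists>M > 0. \<exists>c :: nat \<Rightarrow> nat. \<exists>z :: nat \<Rightarrow> circle \<times> real.
          (\<forall>n. c n < m) \<and> z 0 = p \<and>
          (\<forall>n. skew l A (c n) (z (Suc n)) = z n) \<and> (\<forall>n. \<bar>snd (z n)\<bar> \<le> M)}"

end

theory Submission
  imports Defs
begin

text \<open>A point lies in \<open>\<Lambda>\<close> exactly when it has an infinite past along which the heights stay
  bounded. Both inclusions are a shift of this past. A map applied to a point of \<open>\<Lambda>\<close> only
  prepends one entry, and a single further height cannot destroy boundedness. Conversely, the
  first preimage in a bounded past of a point has the rest of that past as its own, so it lies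
  in \<open>\<Lambda>\<close> and is sent to the point by one of the maps.\<close>

lemma skew_in_bounded_past_set:
  assumes "c < m" and "p \<in> bounded_past_set l m A"
  shows "skew l A c p \<in> bounded_past_set l m A"
proof -
  obtain M d z where "M > 0" and d: "\<And>n. d n < m" and z0: "z 0 = p"
    and step: "\<And>n. skew l A (d n) (z (Suc n)) = z n" and bound: "\<And>n. \<bar>snd (z n)\<bar> \<le> M"
    using assms(2) unfolding bounded_past_set_def by blast
  define M' where "M' = max M \<bar>snd (skew l A c p)\<bar>"
  define d' where "d' = case_nat c d"
  define z' where "z' = case_nat (skew l A c p) z"
  have "M' > 0"
    using \<open>M > 0\<close> by (simp add: M'_def)
  moreover have "\<forall>n. d' n < m"
    using assms(1) d by (simp add: d'_def split: nat.split)
  moreover have "z' 0 = skew l A c p"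
    by (simp add: z'_def)
  moreover have "\<forall>n. skew l A (d' n) (z' (Suc n)) = z' n"
    using z0 step by (simp add: d'_def z'_def split: nat.split)
  moreover have "\<forall>n. \<bar>snd (z' n)\<bar> \<le> M'"
    using bound by (simp add: M'_def z'_def le_max_iff_disj split: nat.split)
  ultimately show ?thesis
    unfolding bounded_past_set_def by blast
qed

lemma bounded_past_set_preimage:
  assumes "p \<in> bounded_past_set l m A"
  obtains c q where "c < m" and "q \<in> bounded_past_set l m A" and "skew l A c q = p"
proof -
  obtain M d z where "M > 0" and d: "\<And>n. d n < m" and z0: "z 0 = p"
    and step: "\<And>n. skew l A (d n) (z (Suc n)) = z n" and bound: "\<And>n. \<bar>snd (z n)\<bar> \<le> M"
    using assms unfolding bounded_past_set_def by blast
  show thesis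
  proof
    show "d 0 < m"
      by (rule d)
    show "skew l A (d 0) (z (Suc 0)) = p"
      using step[of 0] z0 by simp
    show "z (Suc 0) \<in> bounded_past_set l m A"
      unfolding bounded_past_set_def mem_Collect_eq
      using \<open>M > 0\<close> d step bound
      by (intro exI[of _ M] exI[of _ "\<lambda>n. d (Suc n)"] exI[of _ "\<lambda>n. z (Suc n)"] conjI) auto
  qed
qed

theorem proposition2p4:
  fixes l :: real and m :: nat and A :: "nat \<Rightarrow> circle \<Rightarrow> real"
  assumes "0 < l" and "l < 1"
    and "m \<ge> 2"
    and "\<And>c. c < m \<Longrightarrow> \<exists>L. L-lipschitz_on UNIV (A c)"
  shows "skew_union l m A (bounded_past_set l m A) = bounded_past_set l m A"
proof
  show "skew_union l m A (bounded_past_set l m A) \<subseteq> bounded_past_set l m A"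
    unfolding skew_union_def by (auto intro: skew_in_bounded_past_set)
  show "bounded_past_set l m A \<subseteq> skew_union l m A (bounded_past_set l m A)"
  proof
    fix p assume "p \<in> bounded_past_set l m A"
    then obtain c q where "c < m" "q \<in> bounded_past_set l m A" "skew l A c q = p"
      by (rule bounded_past_set_preimage)
    then show "p \<in> skew_union l m A (bounded_past_set l m A)"
      unfolding skew_union_def by blast
  qed
qed

end
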